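(* For every $p\in\mathbb{P}$ with $p>1$: either $p$ is prime, or there exist $q_0,q_1\in\mathbb{P}$ with $q_0>1$, $q_1>1$ and $p=q_0\cdot q_1$.
   Context: $\mathbb{P}=\{1,2,3,\dots\}$ (positive integers represented in binary, with constructors $1$, $p\mapsto 2p$, $p\mapsto 2p+1$). Divisibility on $\mathbb{P}$: $p\mid q$ means $\gcd(p,q)=p$, where $\gcd$ is defined recursively (Stein's algorithm) by $\gcd(1,p)=1$, $\gcd(2p,1)=1$, $\gcd(2p,2q)=2\gcd(p,q)$, $\gcd(2p,2q+1)=\gcd(p,2q+1)$, $\gcd(2p+1,1)=1$, $\gcd(2p+1,2q)=\gcd(2p+1,q)$, and $\gcd(2p+1,2q+1)$ equals $\gcd(2p+1,q-p)$ if $p<q$, $\gcd(p-q,2q+1)$ if $q<p$, and $2p+1$ if $p=q$. Primality on $\mathbb{P}$: $p$ is composed if there is $q\le\lfloor\sqrt p\rfloor$ with $1<q$ and $q\mid p$, where $\lfloor\sqrt p\rfloor$ is the largest $r\in\mathbb{P}$ with $r\cdot r\le p$; $p$ is prime if $p>1$ and $p$ is not composed. The disjunction ("either ... or", inclusive) and the existential quantifiers are understood constructively. *)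

theory Defs
  imports Main
begin

text \<open>
  The type \<^typ>\<open>num\<close> of HOL is the set of positive binary integers: \<^const>\<open>num.One\<close> is 1,
  \<^const>\<open>num.Bit0\<close> is the map from p to 2p and \<^const>\<open>num.Bit1\<close> is the map from p to 2p + 1.  Its
  addition, multiplication and order are those inherited from the natural numbers.
\<close>

text \<open>Only meaningful for \<open>q < p\<close>; \<^typ>\<open>num\<close> has no subtraction of its own.\<close>

definition num_diff :: "num \<Rightarrow> num \<Rightarrow> num" where
  "num_diff p q = num_of_nat (nat_of_num p - nat_of_num q)"

lemma nat_of_num_diff:
  "q < p \<Longrightarrow> nat_of_num (num_diff p q) = nat_of_num p - nat_of_num q"
  by (simp add: num_diff_def less_num_def num_of_nat_inverse)

function num_gcd :: "num \<Rightarrow> num \<Rightarrow> num" where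
  "num_gcd num.One p = num.One"
| "num_gcd (num.Bit0 p) num.One = num.One"
| "num_gcd (num.Bit0 p) (num.Bit0 q) = num.Bit0 (num_gcd p q)"
| "num_gcd (num.Bit0 p) (num.Bit1 q) = num_gcd p (num.Bit1 q)"
| "num_gcd (num.Bit1 p) num.One = num.One"
| "num_gcd (num.Bit1 p) (num.Bit0 q) = num_gcd (num.Bit1 p) q"
| "num_gcd (num.Bit1 p) (num.Bit1 q) =
     (if p < q then num_gcd (num.Bit1 p) (num_diff q p)
      else if q < p then num_gcd (num_diff p q) (num.Bit1 q)
      else num.Bit1 p)"
  by pat_completeness auto
termination
proof (relation "measure (\<lambda>(p, q). nat_of_num p + nat_of_num q)", goal_cases)
  case (2 p q)
  then show ?case using nat_of_num_pos[of p] nat_of_num_pos[of q] by simp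
next
  case (3 p q)
  then show ?case using nat_of_num_pos[of p] by simp
next
  case (4 p q)
  then show ?case using nat_of_num_pos[of q] by simp
qed (auto simp: nat_of_num_diff nat_of_num_pos)

definition num_dvd :: "num \<Rightarrow> num \<Rightarrow> bool" where
  "num_dvd p q \<longleftrightarrow> num_gcd p q = p"

definition num_sqrt :: "num \<Rightarrow> num" where
  "num_sqrt p = (GREATEST r. r * r \<le> p)"

definition num_composed :: "num \<Rightarrow> bool" where
  "num_composed p \<longleftrightarrow> (\<exists>q\<le>num_sqrt p. num.One < q \<and> num_dvd q p)"

definition num_prime :: "num \<Rightarrow> bool" where
  "num_prime p \<longleftrightarrow> num.One < p \<and> \<not> num_composed p"

text \<open>
  A constructive proof of a disjunction or of an existential statement provides a computable choice
  of the disjunct or of the witness, which the classical connectives of HOL do not express.  To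
  state this, we use Kleene's total recursive functions on the natural numbers:
  \<open>recursive_fn n f\<close> says that the
  \<open>n\<close>-ary function \<open>f\<close>, whose arguments are presented as a list of length \<open>n\<close>, is recursive.
  Minimisation is restricted to regular functions, so that all functions stay total.
\<close>

inductive recursive_fn :: "nat \<Rightarrow> (nat list \<Rightarrow> nat) \<Rightarrow> bool" where
  zero: "recursive_fn n (\<lambda>xs. 0)"
| succ: "recursive_fn 1 (\<lambda>xs. Suc (xs ! 0))"
| proj: "i < n \<Longrightarrow> recursive_fn n (\<lambda>xs. xs ! i)"
| comp: "recursive_fn (length gs) f \<Longrightarrow> \<forall>g\<in>set gs. recursive_fn n g \<Longrightarrow>
    recursive_fn n (\<lambda>xs. f (map (\<lambda>g. g xs) gs))"
| prim_rec: "recursive_fn n g \<Longrightarrow> recursive_fn (Suc (Suc n)) h \<Longrightarrow>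
    recursive_fn (Suc n) (\<lambda>xs. rec_nat (g (tl xs)) (\<lambda>k r. h (k # r # tl xs)) (hd xs))"
| minimise: "recursive_fn (Suc n) f \<Longrightarrow> (\<And>xs. length xs = n \<Longrightarrow> \<exists>k. f (k # xs) = 0) \<Longrightarrow>
    recursive_fn n (\<lambda>xs. LEAST k. f (k # xs) = 0)"

definition computable_num :: "(num \<Rightarrow> num) \<Rightarrow> bool" where
  "computable_num f \<longleftrightarrow>
     (\<exists>g. recursive_fn 1 g \<and> (\<forall>p. g [nat_of_num p] = nat_of_num (f p)))"

end

theory Submission
  imports Defs
begin

text \<open>
  Everything rests on the least factor \<open>d \<ge> 2\<close> of a number \<open>n \<ge> 2\<close> and on its cofactor \<open>n / d\<close>.
  If the cofactor is not 1, then \<open>n = d * (n / d)\<close> is a nontrivial factorisation.  If it is 1, then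
  \<open>n\<close> itself is the least factor, whereas a witness \<open>q \<ge> 2\<close> of compositeness would be a factor with
  \<open>q * q \<le> n\<close>, hence one smaller than \<open>n\<close>.  So the cofactor also serves as the computable test that
  decides between the two cases, and the plain disjunction is a consequence of the computable one.

  Two ingredients remain.  The notions on \<^typ>\<open>num\<close> have to be identified with
  those on natural numbers: Stein's algorithm computes the greatest common divisor
  (\<open>nat_of_num_gcd\<close>), and lying below the integer square root means having a square below the number
  (\<open>le_num_sqrt_iff\<close>).  And the least factor and the cofactor have to be recursive: both are defined
  by unbounded minimisation over arithmetic terms chosen such that a zero exists for all arguments,
  including the degenerate ones.
\<close>

section \<open>Divisibility and square roots of binary numbers\<close>

text \<open>
  The step for two odd numbers halves their even difference without changing the result, because 2
  is coprime to an odd number.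
\<close>

lemma gcd_odd_difference:
  fixes a b :: nat
  assumes "a < b"
  shows "gcd (2 * a + 1) (2 * b + 1) = gcd (2 * a + 1) (b - a)"
proof -
  have "gcd (2 * a + 1) (2 * b + 1) = gcd (2 * a + 1) ((2 * a + 1) + 2 * (b - a))"
    using assms by (simp add: algebra_simps)
  also have "\<dots> = gcd (2 * a + 1) (2 * (b - a))"
    by (simp only: gcd_add2)
  also have "\<dots> = gcd (2 * a + 1) (b - a)"
    by (rule gcd_mult_right_left_cancel) simp
  finally show ?thesis .
qed

lemma nat_of_num_gcd:
  "nat_of_num (num_gcd p q) = gcd (nat_of_num p) (nat_of_num q)"
proof (induction p q rule: num_gcd.induct)
  case (3 p q)
  then show ?case
    by (simp add: mult_2[symmetric] gcd_mult_distrib_nat)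
next
  case (4 p q)
  have "gcd (2 * nat_of_num p) (2 * nat_of_num q + 1) = gcd (nat_of_num p) (2 * nat_of_num q + 1)"
    by (rule gcd_mult_left_left_cancel) simp
  with 4 show ?case by (simp add: mult_2)
next
  case (6 p q)
  have "gcd (2 * nat_of_num p + 1) (2 * nat_of_num q) = gcd (2 * nat_of_num p + 1) (nat_of_num q)"
    by (rule gcd_mult_right_left_cancel) simp
  with 6 show ?case by (simp add: mult_2)
next
  case (7 p q)
  consider "p < q" | "q < p" | "p = q" by (rule linorder_cases)
  then show ?case
  proof cases
    case 1
    then have "nat_of_num p < nat_of_num q" by (simp add: less_num_def)
    from gcd_odd_difference[OF this] 7(1) 1 show ?thesis
      by (simp add: nat_of_num_diff mult_2)
  next
    case 2
    then have "nat_of_num q < nat_of_num p" by (simp add: less_num_def)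
    moreover from 2 have "\<not> p < q" by simp
    ultimately show ?thesis using gcd_odd_difference[of "nat_of_num q" "nat_of_num p"] 7(2) 2
      by (simp add: nat_of_num_diff mult_2 gcd.commute)
  qed simp
qed simp_all

lemma num_dvd_iff: "num_dvd p q \<longleftrightarrow> nat_of_num p dvd nat_of_num q"
  by (simp only: num_dvd_def num_eq_iff nat_of_num_gcd gcd_nat.absorb_iff1)

text \<open>
  The greatest \<open>r\<close> with \<open>r * r \<le> p\<close> exists because such \<open>r\<close> are bounded by \<open>p\<close>, and squaring is
  monotone, so exactly the numbers up to it have a square at most \<open>p\<close>.
\<close>

lemma le_num_sqrt_iff: "q \<le> num_sqrt p \<longleftrightarrow> q * q \<le> p"
proof -
  let ?S = "{r. r * r \<le> p}"
  have "nat_of_num ` ?S \<subseteq> {..nat_of_num p}"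
    by (auto simp: less_eq_num_def nat_of_num_mult intro: order_trans[OF le_square])
  then have "finite (nat_of_num ` ?S)" by (rule finite_subset) simp
  then have fin: "finite ?S" by (rule finite_imageD) (simp add: inj_on_def num_eq_iff)
  have "num.One \<in> ?S" by simp
  then have max: "Max ?S \<in> ?S" using Max_in[OF fin] by blast
  have sqrt: "num_sqrt p = Max ?S"
    unfolding num_sqrt_def using max fin by (intro Greatest_equality) auto
  show ?thesis
  proof
    assume "q \<le> num_sqrt p"
    then have "q * q \<le> Max ?S * Max ?S"
      by (simp add: sqrt less_eq_num_def nat_of_num_mult mult_mono)
    with max show "q * q \<le> p" by simp
  next
    assume "q * q \<le> p"
    with fin show "q \<le> num_sqrt p" by (simp add: sqrt)
  qed
qed

lemma num_composed_iff:
  "num_composed p \<longleftrightarrow> (\<exists>q. num.One < q \<and> q * q \<le> p \<and> nat_of_num q dvd nat_of_num p)"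
  by (auto simp: num_composed_def le_num_sqrt_iff num_dvd_iff)

section \<open>Recursive arithmetic\<close>

text \<open>
  Recursiveness of a function of lists constrains its value at lists of every length.  The rules
  below therefore read arguments off by indexing only, so that all functions have the same shape and
  can be plugged into one another.
\<close>

lemma recursive_fn_compose1:
  assumes "recursive_fn 1 f" "recursive_fn n a"
  shows "recursive_fn n (\<lambda>xs. f [a xs])"
  using recursive_fn.comp[of "[a]" f n] assms by simp

lemma recursive_fn_compose2:
  assumes "recursive_fn 2 f" "recursive_fn n a" "recursive_fn n b"
  shows "recursive_fn n (\<lambda>xs. f [a xs, b xs])"
  using recursive_fn.comp[of "[a, b]" f n] assms by (simp add: numeral_2_eq_2)

lemma recursive_fn_Suc:
  "recursive_fn n a \<Longrightarrow> recursive_fn n (\<lambda>xs. Suc (a xs))"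
  using recursive_fn_compose1[OF recursive_fn.succ] by simp

lemma recursive_fn_const: "recursive_fn n (\<lambda>xs. c)"
  by (induction c) (auto intro: recursive_fn.zero recursive_fn_Suc)

text \<open>
  Addition, multiplication and subtraction all recur along one argument with a step that ignores the
  counter.  Composing the recursor with projections hides its use of \<^const>\<open>hd\<close> and \<^const>\<open>tl\<close>,
  which would otherwise not fit with indexing.
\<close>

lemma recursive_fn_iterate:
  assumes "recursive_fn 1 (\<lambda>xs. g (xs ! 0))"
    and "recursive_fn 2 (\<lambda>xs. h (xs ! 0) (xs ! 1))"
    and "\<And>y. F 0 y = g y" "\<And>x y. F (Suc x) y = h (F x y) y"
    and "recursive_fn n a" "recursive_fn n b"
  shows "recursive_fn n (\<lambda>xs. F (a xs) (b xs))"
proof -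
  have F: "rec_nat (g y) (\<lambda>k r. h r y) x = F x y" for x y
    by (induction x) (simp_all add: assms(3,4))
  have "recursive_fn 3 (\<lambda>xs. h (xs ! 1) (xs ! 2))"
    using recursive_fn_compose2[OF assms(2) recursive_fn.proj recursive_fn.proj, of 1 3 2] by simp
  with recursive_fn.prim_rec[OF assms(1), of "\<lambda>xs. h (xs ! 1) (xs ! 2)"]
  have "recursive_fn 2
      (\<lambda>xs. rec_nat (g (tl xs ! 0)) (\<lambda>k r. h r ((r # tl xs) ! 1)) (hd xs))"
    by (simp add: numeral_2_eq_2 numeral_3_eq_3)
  from recursive_fn_compose2[OF this assms(5,6)] show ?thesis by (simp add: F)
qed

lemma recursive_fn_add:
  assumes "recursive_fn n a" "recursive_fn n b"
  shows "recursive_fn n (\<lambda>xs. a xs + b xs)"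
  by (rule recursive_fn_iterate[where g = "\<lambda>y. y" and h = "\<lambda>r y. Suc r" and F = "(+)"])
    (simp_all add: assms recursive_fn.proj recursive_fn_Suc)

lemma recursive_fn_mult:
  assumes "recursive_fn n a" "recursive_fn n b"
  shows "recursive_fn n (\<lambda>xs. a xs * b xs)"
  by (rule recursive_fn_iterate[where g = "\<lambda>y. 0" and h = "\<lambda>r y. r + y" and F = "(*)"])
    (simp_all add: assms recursive_fn.proj recursive_fn.zero recursive_fn_add)

lemma recursive_fn_pred:
  assumes "recursive_fn n a"
  shows "recursive_fn n (\<lambda>xs. a xs - 1)"
proof -
  have "recursive_fn 1 (\<lambda>xs. rec_nat 0 (\<lambda>k r. k) (hd xs))"
    using recursive_fn.prim_rec[OF recursive_fn.zero recursive_fn.proj, of 0 0] by simp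
  from recursive_fn_compose1[OF this assms]
  have "recursive_fn n (\<lambda>xs. rec_nat 0 (\<lambda>k r. k) (a xs))" by simp
  moreover have "rec_nat 0 (\<lambda>k r. k) x = x - 1" for x :: nat by (cases x) auto
  ultimately show ?thesis by simp
qed

lemma recursive_fn_diff:
  assumes "recursive_fn n a" "recursive_fn n b"
  shows "recursive_fn n (\<lambda>xs. a xs - b xs)"
  \<comment> \<open>The recursion runs along the subtrahend, so the arguments are swapped.\<close>
proof (rule recursive_fn_iterate[where g = "\<lambda>y. y" and h = "\<lambda>r y. r - 1"
      and F = "\<lambda>y x. x - y", OF _ _ _ _ assms(2,1)])
  show "recursive_fn 1 (\<lambda>xs. xs ! 0)" by (rule recursive_fn.proj) simp
  show "recursive_fn 2 (\<lambda>xs. xs ! 0 - 1)"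
    by (intro recursive_fn_pred recursive_fn.proj) simp
qed simp_all

section \<open>Least factor and cofactor\<close>

text \<open>
  Division rounded up: for \<open>k > 0\<close>, \<open>n - j * k\<close> vanishes once \<open>j * k\<close> has reached \<open>n\<close>.  The
  second factor \<open>k\<close> only ensures a zero for \<open>k = 0\<close>, as minimisation requires.
\<close>

definition ceil_div :: "nat \<Rightarrow> nat \<Rightarrow> nat" where
  "ceil_div n k = (LEAST j. (n - j * k) * k = 0)"

lemma ceil_div_zero_exists: "\<exists>j. (n - j * k) * k = (0::nat)"
  by (rule exI[of _ n]) (cases k; simp)

lemma ceil_div_ge:
  assumes "k > 0"
  shows "n \<le> ceil_div n k * k"
  using LeastI_ex[OF ceil_div_zero_exists, of n k] assms unfolding ceil_div_def by simp

lemma ceil_div_mult_le_iff: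
  assumes "k > 0"
  shows "ceil_div n k * k \<le> n \<longleftrightarrow> k dvd n"
proof
  assume "ceil_div n k * k \<le> n"
  with ceil_div_ge[OF assms, of n] have "n = ceil_div n k * k" by simp
  then show "k dvd n" by (metis dvd_triv_right)
next
  assume "k dvd n"
  then have "ceil_div n k \<le> n div k" unfolding ceil_div_def by (intro Least_le) simp
  then show "ceil_div n k * k \<le> n" by (metis \<open>k dvd n\<close> dvd_div_mult_self mult_le_mono1)
qed

lemma ceil_div_mult:
  assumes "k > 0" "k dvd n"
  shows "ceil_div n k * k = n"
  using ceil_div_ge[OF assms(1), of n] ceil_div_mult_le_iff[OF assms(1), of n] assms(2) by simp

text \<open>
  The two summands vanish when \<open>k \<ge> 2\<close> and \<open>k dvd n\<close>, respectively.  The factor \<open>n - 1\<close> drops the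
  divisibility condition for \<open>n = 1\<close>, which has no factor \<open>k \<ge> 2\<close>.
\<close>

definition least_factor :: "nat \<Rightarrow> nat" where
  "least_factor n = (LEAST k. (2 - k) + (ceil_div n k * k - n) * (n - 1) = 0)"

lemma least_factor_zero_iff:
  "(2 - k) + (ceil_div n k * k - n) * (n - 1) = (0::nat) \<longleftrightarrow> 2 \<le> k \<and> (k dvd n \<or> n \<le> 1)"
proof (cases "2 \<le> k")
  case True
  then show ?thesis using ceil_div_mult_le_iff[of k n] by auto
qed auto

lemma least_factor_zero_exists: "\<exists>k. (2 - k) + (ceil_div n k * k - n) * (n - 1) = (0::nat)"
  unfolding least_factor_zero_iff by (cases "n \<le> 1") (auto intro: exI[of _ n])

lemma least_factor_props: "2 \<le> least_factor n" "n > 1 \<Longrightarrow> least_factor n dvd n"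
proof -
  have "2 \<le> least_factor n \<and> (least_factor n dvd n \<or> n \<le> 1)"
    using LeastI_ex[OF least_factor_zero_exists, of n]
    unfolding least_factor_def[symmetric] least_factor_zero_iff[of "least_factor n"] .
  then show "2 \<le> least_factor n" "n > 1 \<Longrightarrow> least_factor n dvd n" by auto
qed

lemma least_factor_le: "2 \<le> k \<Longrightarrow> k dvd n \<Longrightarrow> least_factor n \<le> k"
  unfolding least_factor_def least_factor_zero_iff by (intro Least_le) simp

definition cofactor :: "nat \<Rightarrow> nat" where
  "cofactor n = ceil_div n (least_factor n)"

lemma least_factor_mult_cofactor: "n > 1 \<Longrightarrow> least_factor n * cofactor n = n"
  using ceil_div_mult[of "least_factor n" n] least_factor_props[of n]
  by (simp add: cofactor_def mult.commute)

lemma cofactor_pos: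
  assumes "n > 0"
  shows "cofactor n > 0"
proof (rule ccontr)
  assume "\<not> cofactor n > 0"
  then show False
    using ceil_div_ge[of "least_factor n" n] least_factor_props(1)[of n] assms
    by (simp add: cofactor_def)
qed

lemma recursive_fn_ceil_div:
  assumes "recursive_fn n a" "recursive_fn n b"
  shows "recursive_fn n (\<lambda>xs. ceil_div (a xs) (b xs))"
proof -
  let ?f = "\<lambda>xs::nat list. (xs ! 1 - xs ! 0 * xs ! 2) * xs ! 2"
  have "recursive_fn (Suc 2) ?f"
    by (intro recursive_fn_mult recursive_fn_diff recursive_fn.proj) simp_all
  then have "recursive_fn 2 (\<lambda>xs. LEAST k. ?f (k # xs) = 0)"
    by (rule recursive_fn.minimise) (use ceil_div_zero_exists in auto)
  from recursive_fn_compose2[OF this assms] show ?thesis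
    by (simp add: ceil_div_def)
qed

lemma recursive_fn_least_factor:
  assumes "recursive_fn n a"
  shows "recursive_fn n (\<lambda>xs. least_factor (a xs))"
proof -
  let ?f = "\<lambda>xs::nat list.
    (2 - xs ! 0) + (ceil_div (xs ! 1) (xs ! 0) * xs ! 0 - xs ! 1) * (xs ! 1 - 1)"
  have "recursive_fn (Suc 1) ?f"
    by (intro recursive_fn_add recursive_fn_mult recursive_fn_diff recursive_fn_ceil_div
        recursive_fn_const recursive_fn.proj) simp_all
  then have "recursive_fn 1 (\<lambda>xs. LEAST k. ?f (k # xs) = 0)"
    by (rule recursive_fn.minimise) (use least_factor_zero_exists in simp)
  from recursive_fn_compose1[OF this assms] show ?thesis
    by (simp add: least_factor_def)
qed

lemma recursive_fn_cofactor:
  assumes "recursive_fn n a"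
  shows "recursive_fn n (\<lambda>xs. cofactor (a xs))"
  unfolding cofactor_def
  by (intro recursive_fn_ceil_div recursive_fn_least_factor assms)

section \<open>Deciding primality and factoring\<close>

lemma computable_num_of_nat:
  assumes "recursive_fn 1 (\<lambda>xs. h (xs ! 0))" "\<And>n. n > 0 \<Longrightarrow> h n > 0"
  shows "computable_num (\<lambda>p. num_of_nat (h (nat_of_num p)))"
  unfolding computable_num_def
  using assms by (intro exI[of _ "\<lambda>xs. h (xs ! 0)"]) (simp add: num_of_nat_inverse nat_of_num_pos)

lemma num_prime_if_cofactor_1:
  assumes "num.One < p" "cofactor (nat_of_num p) = 1"
  shows "num_prime p"
proof -
  have "nat_of_num p > 1" using assms(1) by (simp add: less_num_def)
  then have least: "least_factor (nat_of_num p) = nat_of_num p"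
    using least_factor_mult_cofactor[of "nat_of_num p"] assms(2) by simp
  have "\<not> num_composed p"
  proof
    assume "num_composed p"
    then obtain q where q: "num.One < q" "q * q \<le> p" "nat_of_num q dvd nat_of_num p"
      by (auto simp: num_composed_iff)
    then have "2 \<le> nat_of_num q" by (simp add: less_num_def)
    moreover from this q least_factor_le have "nat_of_num p \<le> nat_of_num q"
      by (metis least)
    moreover have "nat_of_num q * nat_of_num q \<le> nat_of_num p"
      using q by (simp add: less_eq_num_def nat_of_num_mult)
    moreover have "2 * nat_of_num q \<le> nat_of_num q * nat_of_num q"
      using \<open>2 \<le> nat_of_num q\<close> by (rule mult_le_mono1)
    ultimately show False by linarith
  qed
  with assms(1) show ?thesis by (simp add: num_prime_def)
qed

theorem theorem8:
  shows "(\<forall>p>num.One. num_prime p \<or>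
            (\<exists>q0 q1. num.One < q0 \<and> num.One < q1 \<and> p = q0 * q1)) \<and>
         (\<exists>t f g. computable_num t \<and> computable_num f \<and> computable_num g \<and>
            (\<forall>p>num.One.
               if t p = num.One then num_prime p
               else num.One < f p \<and> num.One < g p \<and> p = f p * g p))"
proof -
  define f where "f p = num_of_nat (least_factor (nat_of_num p))" for p
  define g where "g p = num_of_nat (cofactor (nat_of_num p))" for p
  have least_pos: "least_factor n > 0" for n
    using least_factor_props(1)[of n] by simp
  have f: "computable_num f" unfolding f_def
    by (intro computable_num_of_nat recursive_fn_least_factor recursive_fn.proj least_pos) simp
  have g: "computable_num g" unfolding g_def
    by (intro computable_num_of_nat recursive_fn_cofactor recursive_fn.proj cofactor_pos) simp_all
  have nat_f: "nat_of_num (f p) = least_factor (nat_of_num p)" for p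
    by (simp add: f_def num_of_nat_inverse least_pos)
  have nat_g: "nat_of_num (g p) = cofactor (nat_of_num p)" for p
    by (simp add: g_def num_of_nat_inverse cofactor_pos nat_of_num_pos)
  have decide: "if g p = num.One then num_prime p
      else num.One < f p \<and> num.One < g p \<and> p = f p * g p" if p: "num.One < p" for p
  proof (cases "g p = num.One")
    case True
    with nat_g[of p] have "cofactor (nat_of_num p) = 1" by simp
    with True p num_prime_if_cofactor_1 show ?thesis by simp
  next
    case False
    have "nat_of_num p > 1" using p by (simp add: less_num_def)
    then have "p = f p * g p"
      by (simp add: num_eq_iff nat_of_num_mult nat_f nat_g least_factor_mult_cofactor)
    moreover have "num.One < f p"
      using least_factor_props(1)[of "nat_of_num p"] by (simp add: less_num_def nat_f)
    moreover have "num.One < g p"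
      using False by (cases "g p") simp_all
    ultimately show ?thesis using False by simp
  qed
  have "num_prime p \<or> (\<exists>q0 q1. num.One < q0 \<and> num.One < q1 \<and> p = q0 * q1)"
    if "num.One < p" for p
    using decide[OF that] by (metis (full_types))
  with f g decide show ?thesis by blast
qed

end
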